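(* Let $m\ge1$, let $u$ be a fuzzy set in $F^1_{USCG}(\mathbb{R}^m)$ and for $n=1,2,\ldots$ let $u_n$ be a fuzzy set in $F^1_{USCCON}(\mathbb{R}^m)$. Then $H_{\rm end}(u_n,u)\to0$ as $n\to\infty$ if and only if $\lim_{n\to\infty}^{(\Gamma)}u_n=u$.
   Context: $\mathbb{R}^m$ carries the Euclidean metric $d_m$, and $\mathbb{R}^m\times[0,1]$ carries the metric $\overline{d_m}((x,\alpha),(y,\beta)) = d_m(x,y)+|\alpha-\beta|$. A fuzzy set in $\mathbb{R}^m$ is a function $u:\mathbb{R}^m\to[0,1]$; its $\alpha$-cut is $[u]_\alpha=\{x: u(x)\ge\alpha\}$ for $\alpha\in(0,1]$ and $[u]_0=\overline{\{x:u(x)>0\}}$. $F^1_{USC}(\mathbb{R}^m)$ is the set of fuzzy sets $u$ with $[u]_\alpha$ nonempty and closed for all $\alpha\in[0,1]$ (normal, upper semi-continuous fuzzy sets). $F^1_{USCG}(\mathbb{R}^m)$ is the set of $u\in F^1_{USC}(\mathbb{R}^m)$ with $[u]_\alpha$ compact for all $\alpha\in(0,1]$. $F^1_{USCCON}(\mathbb{R}^m)$ is the set of $u\in F^1_{USC}(\mathbb{R}^m)$ with $[u]_\alpha$ connected in $\mathbb{R}^m$ for all $\alpha\in(0,1]$. The endograph of $u$ is ${\rm end}\,u=\{(x,t)\in\mathbb{R}^m\times[0,1]: u(x)\ge t\}$. Hausdorff distance (possibly $+\infty$) on nonempty closed sets: $H(U,V)=\max\{H^*(U,V),H^*(V,U)\}$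 with $H^*(U,V)=\sup_{a\in U}\inf_{b\in V}\rho(a,b)$, $\rho$ the underlying metric. $H_{\rm end}(u,v)=H({\rm end}\,u,{\rm end}\,v)$, computed with $\overline{d_m}$. A sequence of sets $C_n$ in a metric space Kuratowski converges to $C$ if $C=\liminf C_n=\limsup C_n$, where $\liminf C_n$ is the set of limits of convergent sequences $\{x_n\}$ with $x_n\in C_n$ for all $n$, and $\limsup C_n$ is the set of limits of convergent sequences $\{x_{n_j}\}_j$ with $x_{n_j}\in C_{n_j}$, along some subsequence $n_1<n_2<\cdots$. $\lim_{n\to\infty}^{(\Gamma)}u_n=u$ means that ${\rm end}\,u_n$ Kuratowski converges to ${\rm end}\,u$ in $(\mathbb{R}^m\times[0,1],\overline{d_m})$. *)

theory Defs
  imports "HOL-Analysis.Analysis"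
begin

text \<open>A fuzzy set in \<open>\<real>\<^sup>m\<close> is a function \<open>real ^ 'm \<Rightarrow> real\<close> whose values lie in \<open>{0..1}\<close>.\<close>

definition fuzzy_sets :: "(real ^ 'm \<Rightarrow> real) set" where
  "fuzzy_sets = {u. \<forall>x. u x \<in> {0..1}}"

text \<open>Only meaningful for \<open>\<alpha> \<in> {0..1}\<close>.\<close>

definition cut :: "(real ^ 'm \<Rightarrow> real) \<Rightarrow> real \<Rightarrow> (real ^ 'm) set" where
  "cut u \<alpha> = (if \<alpha> = 0 then closure {x. u x > 0} else {x. u x \<ge> \<alpha>})"

definition F1_USC :: "(real ^ 'm \<Rightarrow> real) set" where
  "F1_USC = {u \<in> fuzzy_sets. \<forall>\<alpha>\<in>{0..1}. cut u \<alpha> \<noteq> {} \<and> closed (cut u \<alpha>)}"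

definition F1_USCG :: "(real ^ 'm \<Rightarrow> real) set" where
  "F1_USCG = {u \<in> F1_USC. \<forall>\<alpha>\<in>{0<..1}. compact (cut u \<alpha>)}"

definition F1_USCCON :: "(real ^ 'm \<Rightarrow> real) set" where
  "F1_USCCON = {u \<in> F1_USC. \<forall>\<alpha>\<in>{0<..1}. connected (cut u \<alpha>)}"

text \<open>The metric space \<open>\<real>\<^sup>m \<times> [0,1]\<close>. Its sum metric is not the \<open>dist\<close> of the product type,
  which is the \<open>\<ell>\<^sup>2\<close> combination; hence the set-based \<open>Metric_space\<close> locale.\<close>

definition end_space :: "((real ^ 'm) \<times> real) set" where
  "end_space = UNIV \<times> {0..1}"

definition end_dist :: "(real ^ 'm) \<times> real \<Rightarrow> (real ^ 'm) \<times> real \<Rightarrow> real" where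
  "end_dist p q = dist (fst p) (fst q) + \<bar>snd p - snd q\<bar>"

lemma Metric_space_end: "Metric_space end_space end_dist"
proof
  show "0 \<le> end_dist p q" for p q :: "(real ^ 'm) \<times> real"
    by (simp add: end_dist_def)
  show "end_dist p q = end_dist q p" for p q :: "(real ^ 'm) \<times> real"
    by (simp add: end_dist_def dist_commute abs_minus_commute)
  show "end_dist p q = 0 \<longleftrightarrow> p = q" for p q :: "(real ^ 'm) \<times> real"
    by (auto simp: end_dist_def prod_eq_iff add_nonneg_eq_0_iff)
  show "end_dist p r \<le> end_dist p q + end_dist q r" for p q r :: "(real ^ 'm) \<times> real"
    using dist_triangle[of "fst p" "fst r" "fst q"] by (simp add: end_dist_def)
qed

definition endograph :: "(real ^ 'm \<Rightarrow> real) \<Rightarrow> ((real ^ 'm) \<times> real) set" where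
  "endograph u = {(x, t). t \<in> {0..1} \<and> u x \<ge> t}"

text \<open>The Hausdorff distance may be infinite, so it takes values in \<open>ennreal\<close>;
  it is intended for nonempty closed sets.\<close>

definition hausdorff_excess :: "('a \<Rightarrow> 'a \<Rightarrow> real) \<Rightarrow> 'a set \<Rightarrow> 'a set \<Rightarrow> ennreal" where
  "hausdorff_excess \<rho> U V = (SUP a\<in>U. INF b\<in>V. ennreal (\<rho> a b))"

definition hausdorff :: "('a \<Rightarrow> 'a \<Rightarrow> real) \<Rightarrow> 'a set \<Rightarrow> 'a set \<Rightarrow> ennreal" where
  "hausdorff \<rho> U V = max (hausdorff_excess \<rho> U V) (hausdorff_excess \<rho> V U)"

definition H_end :: "(real ^ 'm \<Rightarrow> real) \<Rightarrow> (real ^ 'm \<Rightarrow> real) \<Rightarrow> ennreal" where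
  "H_end u v = hausdorff end_dist (endograph u) (endograph v)"

definition kuratowski_liminf ::
    "'a set \<Rightarrow> ('a \<Rightarrow> 'a \<Rightarrow> real) \<Rightarrow> (nat \<Rightarrow> 'a set) \<Rightarrow> 'a set" where
  "kuratowski_liminf M d C =
     {x. \<exists>s. (\<forall>n. s n \<in> C n) \<and> limitin (Metric_space.mtopology M d) s x sequentially}"

definition kuratowski_limsup ::
    "'a set \<Rightarrow> ('a \<Rightarrow> 'a \<Rightarrow> real) \<Rightarrow> (nat \<Rightarrow> 'a set) \<Rightarrow> 'a set" where
  "kuratowski_limsup M d C =
     {x. \<exists>r s. strict_mono r \<and> (\<forall>j. s j \<in> C (r j)) \<and>
           limitin (Metric_space.mtopology M d) s x sequentially}"

definition kuratowski_converges ::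
    "'a set \<Rightarrow> ('a \<Rightarrow> 'a \<Rightarrow> real) \<Rightarrow> (nat \<Rightarrow> 'a set) \<Rightarrow> 'a set \<Rightarrow> bool" where
  "kuratowski_converges M d C L \<longleftrightarrow>
     L = kuratowski_liminf M d C \<and> L = kuratowski_limsup M d C"

definition gamma_limit :: "(nat \<Rightarrow> real ^ 'm \<Rightarrow> real) \<Rightarrow> (real ^ 'm \<Rightarrow> real) \<Rightarrow> bool" where
  "gamma_limit u v \<longleftrightarrow>
     kuratowski_converges end_space end_dist (\<lambda>n. endograph (u n)) (endograph v)"

end

(* The endograph of a fuzzy set contains the whole bottom level t = 0, so in estimating H_end only
   points at height t >= alpha matter, for a small alpha > 0. Over such heights the endograph of u
   is compact. To confine the endographs of the u_n as well, pick p with u p = 1 and R with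
   [u]_alpha contained in the open ball of radius R around p. By Gamma-convergence, eventually
   [u_n]_alpha contains a point near p and misses the sphere of radius R around p; being connected,
   it stays within that ball. On compact sets, Kuratowski convergence is uniform. *)

theory Submission
  imports Defs
begin

section \<open>The sum metric compared with the product metric\<close>

lemma endograph_subset_end_space: "endograph u \<subseteq> end_space"
  by (auto simp: endograph_def end_space_def)

lemma closed_end_space: "closed (end_space :: ((real ^ 'm) \<times> real) set)"
  unfolding end_space_def by (intro closed_Times) auto

text \<open>The Euclidean norm of a pair is at most the sum of its entries. Together with
  \<open>end_dist_le_dist\<close>, where each of the two summands is at most
  \<open>dist p q\<close>, this lets all later limits and estimates use \<open>dist\<close> and the
  type class topology.\<close>

lemma dist_le_end_dist: "dist p q \<le> end_dist p q"
  unfolding end_dist_def dist_prod_def dist_real_def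
  by (rule order_trans[OF sqrt_sum_squares_le_sum_abs]) auto

lemma end_dist_le_dist: "end_dist p q \<le> 2 * dist p q"
  using dist_fst_le[of p q] dist_snd_le[of p q] by (simp add: end_dist_def dist_real_def)

lemma limitin_end_iff_tendsto:
  fixes s :: "nat \<Rightarrow> (real ^ 'm) \<times> real"
  assumes "\<And>n. s n \<in> end_space"
  shows "limitin (Metric_space.mtopology end_space end_dist) s x sequentially \<longleftrightarrow> s \<longlonglongrightarrow> x"
    (is "?l \<longleftrightarrow> ?r")
proof
  assume ?l
  then have "\<forall>e>0. \<forall>\<^sub>F n in sequentially. end_dist (s n) x < e"
    unfolding Metric_space.limitin_metric[OF Metric_space_end]
    by (auto elim!: eventually_mono)
  then show ?r
    unfolding tendsto_iff
    by (auto elim!: eventually_mono intro: order_le_less_trans[OF dist_le_end_dist])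
next
  assume r: ?r
  \<comment> \<open>\<open>limitin\<close> requires the limit to be a point of the space, whereas
    \<open>tendsto\<close> does not; closedness of \<open>end_space\<close> supplies this.\<close>
  have x: "x \<in> end_space"
    using closed_sequentially[OF closed_end_space _ r] assms by blast
  have "\<forall>\<^sub>F n in sequentially. end_dist (s n) x < e" if "e > 0" for e
  proof -
    have "\<forall>\<^sub>F n in sequentially. dist (s n) x < e / 2"
      using tendstoD[OF r, of "e / 2"] that by simp
    then show ?thesis
    proof eventually_elim
      case (elim n)
      then show ?case using end_dist_le_dist[of "s n" x] by simp
    qed
  qed
  then show ?l
    unfolding Metric_space.limitin_metric[OF Metric_space_end] using x assms by auto
qed

section \<open>Gamma-convergence in terms of sequences\<close>

lemma kuratowski_liminf_endograph:
  "x \<in> kuratowski_liminf end_space end_dist (\<lambda>n. endograph (un n)) \<longleftrightarrow>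
     (\<exists>s. (\<forall>n. s n \<in> endograph (un n)) \<and> s \<longlonglongrightarrow> x)"
proof -
  have "limitin (Metric_space.mtopology end_space end_dist) s x sequentially \<longleftrightarrow> s \<longlonglongrightarrow> x"
    if "\<forall>n. s n \<in> endograph (un n)" for s
    by (rule limitin_end_iff_tendsto) (use that endograph_subset_end_space in blast)
  then show ?thesis
    unfolding kuratowski_liminf_def by blast
qed

lemma kuratowski_limsup_endograph:
  "x \<in> kuratowski_limsup end_space end_dist (\<lambda>n. endograph (un n)) \<longleftrightarrow>
     (\<exists>r s. strict_mono r \<and> (\<forall>j. s j \<in> endograph (un (r j))) \<and> s \<longlonglongrightarrow> x)"
proof -
  have "limitin (Metric_space.mtopology end_space end_dist) s x sequentially \<longleftrightarrow> s \<longlonglongrightarrow> x"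
    if "\<forall>j. s j \<in> endograph (un (r j))" for r :: "nat \<Rightarrow> nat" and s
    by (rule limitin_end_iff_tendsto) (use that endograph_subset_end_space in blast)
  then show ?thesis
    unfolding kuratowski_limsup_def by blast
qed

lemma gamma_limit_iff:
  "gamma_limit un u \<longleftrightarrow>
     (\<forall>x \<in> endograph u. \<exists>s. (\<forall>n. s n \<in> endograph (un n)) \<and> s \<longlonglongrightarrow> x) \<and>
     (\<forall>r s x. strict_mono r \<longrightarrow> (\<forall>j. s j \<in> endograph (un (r j))) \<longrightarrow> s \<longlonglongrightarrow> x \<longrightarrow> x \<in> endograph u)"
    (is "?G \<longleftrightarrow> ?I \<and> ?S")
proof -
  let ?li = "kuratowski_liminf end_space end_dist (\<lambda>n. endograph (un n))"
  let ?ls = "kuratowski_limsup end_space end_dist (\<lambda>n. endograph (un n))"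
  \<comment> \<open>The full sequence is a subsequence along the identity. Hence the two equalities
    that define convergence collapse to one inclusion for each of the two limits.\<close>
  have "?li \<subseteq> ?ls"
    unfolding subset_iff kuratowski_liminf_endograph kuratowski_limsup_endograph
    using strict_mono_id by (metis id_apply)
  then have "?G \<longleftrightarrow> endograph u \<subseteq> ?li \<and> ?ls \<subseteq> endograph u"
    unfolding gamma_limit_def kuratowski_converges_def by blast
  also have "endograph u \<subseteq> ?li \<longleftrightarrow> ?I"
    unfolding subset_iff kuratowski_liminf_endograph by blast
  also have "?ls \<subseteq> endograph u \<longleftrightarrow> ?S"
    unfolding subset_iff kuratowski_limsup_endograph by blast
  finally show ?thesis .
qed

section \<open>Hausdorff distance in terms of epsilon-neighbourhoods\<close>

lemma hausdorff_excess_le: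
  assumes "\<And>a. a \<in> U \<Longrightarrow> \<exists>b\<in>V. \<rho> a b \<le> e"
  shows "hausdorff_excess \<rho> U V \<le> ennreal e"
  unfolding hausdorff_excess_def
proof (rule SUP_least)
  fix a
  assume "a \<in> U"
  then obtain b where "b \<in> V" "\<rho> a b \<le> e"
    using assms by blast
  then show "(INF b\<in>V. ennreal (\<rho> a b)) \<le> ennreal e"
    by (intro INF_lower2[of b] ennreal_leI)
qed

lemma hausdorff_excess_lessD:
  assumes "hausdorff_excess \<rho> U V < ennreal e" "a \<in> U"
  shows "\<exists>b\<in>V. \<rho> a b < e"
proof -
  have "(INF b\<in>V. ennreal (\<rho> a b)) < ennreal e"
    using assms unfolding hausdorff_excess_def by (meson SUP_lessD)
  then obtain b where "b \<in> V" "ennreal (\<rho> a b) < ennreal e"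
    by (auto simp: INF_less_iff)
  then show ?thesis
    by (meson ennreal_leI leI leD)
qed

lemma H_end_tendsto_0_iff:
  "(\<lambda>n. H_end (un n) u) \<longlonglongrightarrow> 0 \<longleftrightarrow>
     (\<forall>e>0. \<forall>\<^sub>F n in sequentially.
        (\<forall>a\<in>endograph (un n). \<exists>b\<in>endograph u. dist a b < e) \<and>
        (\<forall>a\<in>endograph u. \<exists>b\<in>endograph (un n). dist a b < e))"
    (is "?l \<longleftrightarrow> (\<forall>e>0. \<forall>\<^sub>F n in sequentially. ?P e n)")
proof (intro iffI allI impI)
  fix e :: real
  assume "?l" "e > 0"
  then have "\<forall>\<^sub>F n in sequentially. H_end (un n) u < ennreal e"
    by (intro order_tendstoD) auto
  then show "\<forall>\<^sub>F n in sequentially. ?P e n"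
  proof eventually_elim
    case (elim n)
    then have "hausdorff_excess end_dist (endograph (un n)) (endograph u) < ennreal e"
      "hausdorff_excess end_dist (endograph u) (endograph (un n)) < ennreal e"
      unfolding H_end_def hausdorff_def by auto
    then show ?case
      by (meson hausdorff_excess_lessD dist_le_end_dist order_le_less_trans)
  qed
next
  assume P: "\<forall>e>0. \<forall>\<^sub>F n in sequentially. ?P e n"
  show ?l
  proof (rule order_tendstoI)
    fix c :: ennreal
    assume "0 < c"
    \<comment> \<open>The bound \<open>c\<close> may be infinite, and a supremum of distances below
      \<open>e\<close> is only known to be \<le> \<open>e\<close>; a finite \<open>e\<close>
      strictly below \<open>c\<close> handles both.\<close>
    then obtain e where e: "0 < e" "ennreal e < c"
      by (metis dense ennreal_cases ennreal_less_zero_iff less_top_ennreal order_less_trans)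
    \<comment> \<open>Half of \<open>e\<close> pays for the factor 2 in
      \<open>end_dist_le_dist\<close>.\<close>
    have "\<forall>\<^sub>F n in sequentially. ?P (e / 2) n"
      using P[rule_format, of "e / 2"] e by simp
    then show "\<forall>\<^sub>F n in sequentially. H_end (un n) u < c"
    proof eventually_elim
      case (elim n)
      have le: "end_dist a b \<le> e" if "dist a b < e / 2" for a b :: "(real ^ 'a) \<times> real"
        using end_dist_le_dist[of a b] that by simp
      have "H_end (un n) u \<le> ennreal e"
        unfolding H_end_def hausdorff_def
        by (intro max.boundedI hausdorff_excess_le) (meson elim le)+
      then show ?case using e by simp
    qed
  qed simp
qed

section \<open>Closedness of the endograph\<close>

lemma endograph_eq_Inter_cut:
  assumes "u \<in> fuzzy_sets"
  shows "endograph u = (UNIV \<times> {0..1}) \<inter> (\<Inter>\<alpha>\<in>{0<..1}. UNIV \<times> {..\<alpha>} \<union> cut u \<alpha> \<times> UNIV)"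
proof (intro set_eqI iffI; clarsimp simp: endograph_def cut_def)
  fix x t
  assume t: "0 \<le> t" "t \<le> 1" and *: "\<forall>\<alpha>\<in>{0<..1}. t \<le> \<alpha> \<or> \<alpha> \<le> u x"
  show "t \<le> u x"
  proof (rule ccontr)
    assume "\<not> t \<le> u x"
    moreover have "0 \<le> u x"
      using assms by (auto simp: fuzzy_sets_def)
    ultimately show False
      \<comment> \<open>The midpoint separates \<open>u x\<close> from \<open>t\<close>. As 0 \<le>
        \<open>u x\<close> < \<open>t\<close> \<le> 1, it is a level in \<open>{0<..1}\<close>, so
        the closure in the definition of \<open>cut u 0\<close> never enters.\<close>
      using *[rule_format, of "(u x + t) / 2"] t by (auto simp: field_simps)
  qed
qed

text \<open>Upper semicontinuity is given level by level, as closedness of the cuts; the preceding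
  formula turns it into closedness of an intersection of closed sets.\<close>

lemma closed_endograph:
  assumes "u \<in> F1_USC"
  shows "closed (endograph u)"
proof -
  have "closed (cut u \<alpha>)" if "\<alpha> \<in> {0<..1}" for \<alpha>
    using assms that by (auto simp: F1_USC_def)
  moreover have "u \<in> fuzzy_sets"
    using assms by (simp add: F1_USC_def)
  ultimately show ?thesis
    by (auto simp: endograph_eq_Inter_cut intro!: closed_Int closed_INT closed_Un closed_Times)
qed

section \<open>Uniformity on compact sets, and confinement to a ball\<close>

lemma eventually_disjoint_of_limsup:
  fixes K L :: "'a::metric_space set"
  assumes "compact K" "K \<inter> L = {}"
    and "\<And>r s x. strict_mono r \<Longrightarrow> (\<forall>j. s j \<in> C (r j)) \<Longrightarrow> s \<longlonglongrightarrow> x \<Longrightarrow> x \<in> L"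
  shows "\<forall>\<^sub>F n in sequentially. K \<inter> C n = {}"
proof (rule ccontr)
  assume "\<not> ?thesis"
  then obtain r :: "nat \<Rightarrow> nat" where r: "strict_mono r" "\<And>j. K \<inter> C (r j) \<noteq> {}"
    using not_eventually_sequentiallyD by blast
  from r(2) have "\<forall>j. \<exists>x. x \<in> K \<and> x \<in> C (r j)"
    by blast
  then obtain s where s: "\<And>j. s j \<in> K" "\<And>j. s j \<in> C (r j)"
    by metis
  \<comment> \<open>Points of \<open>K\<close> lying in infinitely many of the sets accumulate at
    some \<open>x\<close> in \<open>K\<close>; being a limit along a subsequence, \<open>x\<close>
    also lies in \<open>L\<close>.\<close>
  obtain x r' where x: "x \<in> K" "strict_mono r'" "(s \<circ> r') \<longlonglongrightarrow> x"
    using seq_compactE[OF compact_imp_seq_compact[OF assms(1)], of s] s(1) by metis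
  have "x \<in> L"
    using assms(3)[of "r \<circ> r'" "s \<circ> r'" x] r x s by (simp add: strict_mono_o)
  then show False
    using x assms(2) by blast
qed

text \<open>Compactness makes pointwise approximation uniform: points of \<open>K\<close> staying at
  distance at least \<open>e\<close> from infinitely many \<open>C n\<close> would accumulate at
  some \<open>x\<close> in \<open>K\<close>, and the sequence approximating \<open>x\<close> would
  come within \<open>e\<close> of them.\<close>

lemma eventually_near_of_liminf:
  fixes K L :: "'a::metric_space set"
  assumes "compact K" "K \<subseteq> L" "e > 0"
    and "\<And>x. x \<in> L \<Longrightarrow> \<exists>s. (\<forall>n. s n \<in> C n) \<and> s \<longlonglongrightarrow> x"
  shows "\<forall>\<^sub>F n in sequentially. \<forall>a\<in>K. \<exists>b\<in>C n. dist a b < e"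
proof (rule ccontr)
  assume "\<not> ?thesis"
  then obtain r :: "nat \<Rightarrow> nat" where r: "strict_mono r" "\<And>j. \<exists>a\<in>K. \<forall>b\<in>C (r j). \<not> dist a b < e"
    by (auto dest!: not_eventually_sequentiallyD)
  then obtain a where a: "\<And>j. a j \<in> K" "\<And>j b. b \<in> C (r j) \<Longrightarrow> \<not> dist (a j) b < e"
    by metis
  obtain x r' where x: "x \<in> K" "strict_mono r'" "(a \<circ> r') \<longlonglongrightarrow> x"
    using seq_compactE[OF compact_imp_seq_compact[OF assms(1)], of a] a(1) by metis
  obtain s where s: "\<And>n. s n \<in> C n" "s \<longlonglongrightarrow> x"
    using assms(2,4) x(1) by blast
  have "(s \<circ> (r \<circ> r')) \<longlonglongrightarrow> x"
    using LIMSEQ_subseq_LIMSEQ[OF s(2)] r(1) x(2) strict_mono_o by blast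
  with x(3) have "(\<lambda>j. dist ((a \<circ> r') j) ((s \<circ> (r \<circ> r')) j)) \<longlonglongrightarrow> dist x x"
    by (rule tendsto_dist)
  then have "\<forall>\<^sub>F j in sequentially. dist ((a \<circ> r') j) ((s \<circ> (r \<circ> r')) j) < e"
    using assms(3) by (intro order_tendstoD) auto
  then show False
    using a(2) s(1) by (auto simp: eventually_sequentially)
qed

text \<open>A point of the endograph at height at least \<alpha> lies over
  \<open>cut u \<alpha>\<close>, so this closed set sits inside a compact product.\<close>

lemma compact_endograph_above:
  assumes "u \<in> F1_USCG" "0 < \<alpha>" "\<alpha> \<le> 1"
  shows "compact {q \<in> endograph u. \<alpha> \<le> snd q}"
proof -
  have "closed (endograph u \<inter> {q. \<alpha> \<le> snd q})"
    using assms by (intro closed_Int closed_endograph closed_Collect_le continuous_intros)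
      (auto simp: F1_USCG_def)
  moreover have "compact (cut u \<alpha> \<times> {0..1::real})"
    using assms by (intro compact_Times) (auto simp: F1_USCG_def)
  moreover have "{q \<in> endograph u. \<alpha> \<le> snd q} = (cut u \<alpha> \<times> {0..1}) \<inter> (endograph u \<inter> {q. \<alpha> \<le> snd q})"
    using assms by (auto simp: endograph_def cut_def)
  ultimately show ?thesis
    by (metis compact_Int_closed)
qed

text \<open>On a connected set the distance to \<open>p\<close> takes every intermediate value, so
  it cannot get from below \<open>R\<close> to \<open>R\<close> or beyond without taking the value
  \<open>R\<close>.\<close>

lemma connected_subset_ball:
  fixes p :: "'a::metric_space"
  assumes "connected S" "S \<inter> sphere p R = {}" "S \<inter> ball p R \<noteq> {}"
  shows "S \<subseteq> ball p R"
proof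
  fix x
  assume x: "x \<in> S"
  obtain y where y: "y \<in> S" "dist p y < R"
    using assms(3) by auto
  show "x \<in> ball p R"
  proof (rule ccontr)
    assume "x \<notin> ball p R"
    moreover have "connected (dist p ` S)"
      using assms(1) by (intro connected_continuous_image continuous_intros)
    ultimately have "R \<in> dist p ` S"
      using connectedD_interval[of "dist p ` S" "dist p y" "dist p x" R] x y by auto
    then show False
      using assms(2) by auto
  qed
qed

section \<open>The two implications\<close>

lemma gamma_limit_if_H_end_tendsto_0:
  assumes "u \<in> F1_USC" "(\<lambda>n. H_end (un n) u) \<longlonglongrightarrow> 0" "\<And>n. endograph (un n) \<noteq> {}"
  shows "gamma_limit un u"
  unfolding gamma_limit_iff
proof (intro conjI ballI allI impI)
  have ev: "\<forall>\<^sub>F n in sequentially.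
        (\<forall>a\<in>endograph (un n). \<exists>b\<in>endograph u. dist a b < e) \<and>
        (\<forall>a\<in>endograph u. \<exists>b\<in>endograph (un n). dist a b < e)" if "e > 0" for e
    using assms(2) that unfolding H_end_tendsto_0_iff by blast
  {
    fix x
    assume x: "x \<in> endograph u"
    \<comment> \<open>One sequence has to serve all \<open>e\<close> and to lie in every endograph,
      so each \<open>s n\<close> is chosen nearest to \<open>x\<close> up to a slack that vanishes
      as \<open>n\<close> grows.\<close>
    define s where "s n = (SOME b. b \<in> endograph (un n) \<and>
      dist x b < infdist x (endograph (un n)) + 1 / Suc n)" for n
    have "\<exists>b. b \<in> endograph (un n) \<and> dist x b < infdist x (endograph (un n)) + 1 / Suc n" for n
    proof -
      have "(INF b\<in>endograph (un n). dist x b) < infdist x (endograph (un n)) + 1 / Suc n"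
        using infdist_notempty[OF assms(3), of x n] by simp
      then show ?thesis
        using cInf_lessD[of "dist x ` endograph (un n)"] assms(3)[of n] by blast
    qed
    then have s: "s n \<in> endograph (un n)" "dist x (s n) < infdist x (endograph (un n)) + 1 / Suc n" for n
      unfolding s_def by (metis (mono_tags, lifting) someI_ex)+
    have "\<forall>\<^sub>F n in sequentially. dist (s n) x < e" if "e > 0" for e
    proof -
      have "\<forall>\<^sub>F n in sequentially. 1 / Suc n < e / 2"
        using that by (intro order_tendstoD[OF LIMSEQ_Suc[OF lim_1_over_n]]) auto
      moreover have "\<forall>\<^sub>F n in sequentially. \<exists>b\<in>endograph (un n). dist x b < e / 2"
        using ev[of "e / 2"] x that by (auto elim!: eventually_mono)
      ultimately show ?thesis
      proof eventually_elim
        case (elim n)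
        then obtain b where "b \<in> endograph (un n)" "dist x b < e / 2" by blast
        then have "infdist x (endograph (un n)) < e / 2"
          by (meson infdist_le order_le_less_trans)
        then show ?case using s(2)[of n] elim(1) by (simp add: dist_commute)
      qed
    qed
    then have "s \<longlonglongrightarrow> x" by (simp add: tendsto_iff)
    then show "\<exists>s. (\<forall>n. s n \<in> endograph (un n)) \<and> s \<longlonglongrightarrow> x"
      using s(1) by blast
  next
    fix r s x
    assume r: "strict_mono r" and s: "\<forall>j. s j \<in> endograph (un (r j))" "s \<longlonglongrightarrow> x"
    \<comment> \<open>\<open>x\<close> is within \<open>e / 2\<close> of some \<open>s j\<close>,
      which is within \<open>e / 2\<close> of \<open>endograph u\<close>; thus \<open>x\<close> lies
      in the closure.\<close>
    have "\<exists>b\<in>endograph u. dist b x < e" if "e > 0" for e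
    proof -
      have "\<forall>\<^sub>F j in sequentially. dist (s j) x < e / 2"
        using tendstoD[OF s(2), of "e / 2"] that by simp
      moreover have "\<forall>\<^sub>F j in sequentially. \<exists>b\<in>endograph u. dist (s j) b < e / 2"
        using eventually_subseq[OF r ev[of "e / 2"]] that s(1) by (auto elim!: eventually_mono)
      ultimately have "\<forall>\<^sub>F j in sequentially. \<exists>b\<in>endograph u. dist b x < e"
      proof eventually_elim
        case (elim j)
        then show ?case by (metis dist_commute dist_triangle_half_r)
      qed
      then show ?thesis by (auto simp: eventually_sequentially)
    qed
    then have "x \<in> closure (endograph u)"
      by (simp add: closure_approachable)
    then show "x \<in> endograph u"
      using closed_endograph[OF assms(1)] by (simp add: closure_closed)
  }
qed

lemma H_end_tendsto_0_if_gamma_limit: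
  fixes u :: "real ^ 'm \<Rightarrow> real"
  assumes u: "u \<in> F1_USCG" and un: "\<And>n. un n \<in> F1_USCCON" and "gamma_limit un u"
  shows "(\<lambda>n. H_end (un n) u) \<longlonglongrightarrow> 0"
  unfolding H_end_tendsto_0_iff
proof (intro allI impI eventually_conj)
  note gamma = assms(3)[unfolded gamma_limit_iff]
  have liminf: "\<exists>s. (\<forall>n. s n \<in> endograph (un n)) \<and> s \<longlonglongrightarrow> x" if "x \<in> endograph u" for x
    using gamma that by blast
  have limsup: "x \<in> endograph u"
    if "strict_mono r" "\<forall>j. s j \<in> endograph (un (r j))" "s \<longlonglongrightarrow> x" for r s x
    using gamma that by blast
  have nonneg: "0 \<le> u x" "0 \<le> un n x" for x n
    using u un by (auto simp: F1_USCG_def F1_USCCON_def F1_USC_def fuzzy_sets_def)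
  then have bottom: "(x, 0) \<in> endograph u" "(x, 0) \<in> endograph (un n)" for x n
    by (auto simp: endograph_def)
  fix e :: real
  assume e: "e > 0"
  \<comment> \<open>\<alpha> \<le> \<open>e\<close> lets points below height \<alpha> be matched
    with the bottom level; \<alpha> < 1 leaves room between height \<alpha> and the peak
    \<open>(p, 1)\<close> used below.\<close>
  define \<alpha> where "\<alpha> = min e (1 / 2)"
  have \<alpha>: "0 < \<alpha>" "\<alpha> \<le> e" "\<alpha> < 1"
    using e by (auto simp: \<alpha>_def)
  have low: "dist (x, t) (x, 0) < e" if "0 \<le> t" "t < \<alpha>" for x :: "real ^ 'm" and t :: real
    using that \<alpha> by (simp add: dist_Pair_Pair)

  have "\<forall>\<^sub>F n in sequentially. \<forall>a\<in>{q \<in> endograph u. \<alpha> \<le> snd q}. \<exists>b\<in>endograph (un n). dist a b < e"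
    using compact_endograph_above[OF u] \<alpha> e liminf
    by (intro eventually_near_of_liminf[where L = "endograph u"]) auto
  then show "\<forall>\<^sub>F n in sequentially. \<forall>a\<in>endograph u. \<exists>b\<in>endograph (un n). dist a b < e"
  proof eventually_elim
    case (elim n)
    show ?case
    proof
      fix a assume a: "a \<in> endograph u"
      show "\<exists>b\<in>endograph (un n). dist a b < e"
      proof (cases "\<alpha> \<le> snd a")
        case True
        then show ?thesis using elim a by blast
      next
        case False
        then have "dist a (fst a, 0) < e"
          using low[of "snd a" "fst a"] a by (auto simp: endograph_def)
        then show ?thesis using bottom by blast
      qed
    qed
  qed

  have "cut u 1 \<noteq> {}"
    using u by (auto simp: F1_USCG_def F1_USC_def)
  then obtain p where "1 \<le> u p"
    by (auto simp: cut_def)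
  then have p: "(p, 1) \<in> endograph u"
    by (auto simp: endograph_def)
  have "bounded (cut u \<alpha>)"
    using u \<alpha> by (auto simp: F1_USCG_def intro!: compact_imp_bounded)
  then obtain R where R: "R > 0" "cut u \<alpha> \<subseteq> ball p R"
    using bounded_subset_ballD by blast
  \<comment> \<open>The single height \<alpha> suffices: endographs are closed downwards, so any
    point of an \<alpha>-cut on the sphere gives an endograph point at exactly this height.\<close>
  have "(sphere p R \<times> {\<alpha>}) \<inter> endograph u = {}"
    using R(2) \<alpha> by (fastforce simp: endograph_def cut_def)
  then have sphere: "\<forall>\<^sub>F n in sequentially. (sphere p R \<times> {\<alpha>}) \<inter> endograph (un n) = {}"
    using limsup by (intro eventually_disjoint_of_limsup[where L = "endograph u"] compact_Times) auto
  \<comment> \<open>The points violating the desired estimate form a closed set disjoint from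
    \<open>endograph u\<close>; within a bounded cylinder it is compact, so the endographs of
    \<open>un n\<close> eventually avoid that part of it.\<close>
  define far where "far = {q. \<forall>b\<in>endograph u. e \<le> dist q b}"
  have "closed far"
    unfolding far_def Ball_def
    by (intro closed_Collect_all closed_Collect_imp closed_Collect_le continuous_intros) auto
  then have "compact ((cball p R \<times> {0..1}) \<inter> far)"
    by (intro compact_Int_closed compact_Times) auto
  moreover have "((cball p R \<times> {0..1}) \<inter> far) \<inter> endograph u = {}"
    using e by (force simp: far_def)
  ultimately have far: "\<forall>\<^sub>F n in sequentially. ((cball p R \<times> {0..1}) \<inter> far) \<inter> endograph (un n) = {}"
    using limsup by (intro eventually_disjoint_of_limsup[where L = "endograph u"]) auto
  \<comment> \<open>Closeness \<open>R\<close> puts the base point of \<open>s n\<close> in the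
    ball, and closeness \<open>1 - \<alpha>\<close> puts its height above \<alpha>; so
    \<open>cut (un n) \<alpha>\<close> meets the ball.\<close>
  have "min R (1 - \<alpha>) > 0"
    using R \<alpha> by simp
  moreover obtain s where s: "\<And>n. s n \<in> endograph (un n)" "s \<longlonglongrightarrow> (p, 1)"
    using liminf[OF p] by blast
  ultimately have near: "\<forall>\<^sub>F n in sequentially. dist (s n) (p, 1) < min R (1 - \<alpha>)"
    using tendstoD by blast
  from sphere far near
  show "\<forall>\<^sub>F n in sequentially. \<forall>a\<in>endograph (un n). \<exists>b\<in>endograph u. dist a b < e"
  proof eventually_elim
    case (elim n)
    have "dist (fst (s n)) p < R" "dist (snd (s n)) 1 < 1 - \<alpha>"
      using elim(3) dist_fst_le[of "s n" "(p, 1)"] dist_snd_le[of "s n" "(p, 1)"] by auto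
    then have "fst (s n) \<in> cut (un n) \<alpha> \<inter> ball p R"
      using s(1)[of n] \<alpha> by (auto simp: endograph_def cut_def dist_commute dist_real_def)
    moreover have "connected (cut (un n) \<alpha>)"
      using un[of n] \<alpha> by (auto simp: F1_USCCON_def)
    moreover have "cut (un n) \<alpha> \<inter> sphere p R = {}"
      using elim(1) \<alpha> by (auto simp: endograph_def cut_def)
    ultimately have cut: "cut (un n) \<alpha> \<subseteq> ball p R"
      by (intro connected_subset_ball) auto
    show ?case
    proof
      fix a assume a: "a \<in> endograph (un n)"
      show "\<exists>b\<in>endograph u. dist a b < e"
      \<comment> \<open>High points lie over the confined cut, hence in the cylinder and outside
        \<open>far\<close>; low points are projected to the bottom level.\<close>
      proof (cases "\<alpha> \<le> snd a")
        case True
        then have "fst a \<in> cut (un n) \<alpha>"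
          using a \<alpha> by (auto simp: endograph_def cut_def)
        then have "a \<in> cball p R \<times> {0..1}"
          using a cut by (auto simp: endograph_def)
        then have "a \<notin> far"
          using elim(2) a by blast
        then show ?thesis
          by (auto simp: far_def not_le)
      next
        case False
        then have "dist a (fst a, 0) < e"
          using low[of "snd a" "fst a"] a by (auto simp: endograph_def)
        then show ?thesis using bottom by blast
      qed
    qed
  qed
qed

theorem theorem4p10:
  fixes u :: "real ^ 'm \<Rightarrow> real" and un :: "nat \<Rightarrow> real ^ 'm \<Rightarrow> real"
  assumes "u \<in> F1_USCG" and "\<And>n. un n \<in> F1_USCCON"
  shows "(\<lambda>n. H_end (un n) u) \<longlonglongrightarrow> 0 \<longleftrightarrow> gamma_limit un u"
proof
  assume "(\<lambda>n. H_end (un n) u) \<longlonglongrightarrow> 0"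
  moreover have "(0, 0) \<in> endograph (un n)" for n
    using assms(2)[of n] by (auto simp: F1_USCCON_def F1_USC_def fuzzy_sets_def endograph_def)
  ultimately show "gamma_limit un u"
    using assms(1) by (intro gamma_limit_if_H_end_tendsto_0) (auto simp: F1_USCG_def)
qed (rule H_end_tendsto_0_if_gamma_limit[OF assms])

end
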